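(* Let $A\in\mathbb{R}^{m\times n}$, $C\in\mathbb{R}^{p\times n}$, and $H:=\max_{J\in\mathcal{S}(A;C)}H_J$, where $$H_J:=\max_{w\in\mathbb{R}^p,\ \|w\|\le1}\ \min_{x\in\mathbb{R}^n,\ Ax=0,\ C_Jx\le w_J}\|x\|.$$ For each $J\in\mathcal{S}(A;C)$ the following identities hold: $$H_J=\max_{\substack{(v,z)\in(A\mathbb{R}^n)\times\mathbb{R}^p_+\\ z_{J^c}=0,\ \|A^{\mathsf T}v+C^{\mathsf T}z\|^*\le1}}\|z\|^*=\frac{1}{\displaystyle\min_{\substack{(v,z)\in(A\mathbb{R}^n)\times\mathbb{R}^p_+\\ z_{J^c}=0,\ \|z\|^*=1}}\|A^{\mathsf T}v+C^{\mathsf T}z\|^*}.$$ For all $b\in\mathbb{R}^m$, $d\in\mathbb{R}^p$ such that $A^{-1}(b)\cap P_{C,d}\neq\emptyset$ and all $u\in A^{-1}(b)$ $$\mathrm{dist}(u,A^{-1}(b)\cap P_{C,d})\le H\cdot\mathrm{dist}(d,Cu+\mathbb{R}^p_+)\le H\cdot\|(Cu-d)_+\|.$$ The first bound is tight: if $H>0$ then there exist $b\in\mathbb{R}^m$, $d\in\mathbb{R}^p$ such that $A^{-1}(b)\cap P_{C,d}\neq\emptyset$ and $u\in A^{-1}(b)\setminus P_{C,d}$ such that $$\mathrm{dist}(u,A^{-1}(b)\cap P_{C,d})=H\cdot\mathrm{dist}(d,Cu+\mathbb{R}^p_+).$$ If $[A,C,\{1,\dots,p\}]:\mathbb{R}^n\rightrightarrows\mathbb{R}^m\times\mathbb{R}^p$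 is surjective then $$H=\max_{\substack{(v,z)\in\mathbb{R}^m\times\mathbb{R}^p_+\\ \|A^{\mathsf T}v+C^{\mathsf T}z\|^*\le1}}\|z\|^*=\frac{1}{\displaystyle\min_{\substack{(v,z)\in\mathbb{R}^m\times\mathbb{R}^p_+\\ \|z\|^*=1}}\|A^{\mathsf T}v+C^{\mathsf T}z\|^*}.$$
   Context: $\mathbb{R}^n$ and $\mathbb{R}^p$ are each endowed with an arbitrary norm $\|\cdot\|$, and all spaces with the standard inner product. $\|\cdot\|^*$ denotes the dual norm on $\mathbb{R}^n$ and on $\mathbb{R}^p$: $\|u\|^*=\max\{\langle u,x\rangle:\|x\|\le1\}$. A minimum over an empty set is $+\infty$ and $1/(+\infty)=0$. $\mathrm{dist}(u,S)=\inf\{\|u-x\|:x\in S\}$; $(y)_+=\max(0,y)$ componentwise; $A\mathbb{R}^n=\{Ax:x\in\mathbb{R}^n\}$; $A^{-1}(b)=\{x\in\mathbb{R}^n:Ax=b\}$; $P_{C,d}=\{x\in\mathbb{R}^n:Cx\le d\}$. For $J\subseteq\{1,\dots,p\}$, $J^c=\{1,\dots,p\}\setminus J$, $C_J$ is the submatrix of rows of $C$ in $J$, and $w_J$ the corresponding subvector. For $J\subseteq\{1,\dots,p\}$, $[A,C,J]:\mathbb{R}^n\rightrightarrows\mathbb{R}^m\times\mathbb{R}^p$ is the set-valued mapping $x\mapsto\{(Ax,Cx+s):s\in\mathbb{R}^p,\ s_J\ge0\}$. A set-valued mapping is surjective if the union of its values is the whole target space, and relatively surjective if that union is a linear subspace.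 $\mathcal{S}(A;C)=\{J\subseteq\{1,\dots,p\}:[A,C,J]\text{ is relatively surjective}\}$. *)

theory Defs
  imports "HOL-Analysis.Analysis"
begin

text \<open>The norm of the library on \<open>real ^ 'k\<close> is the Euclidean one; arbitrary norms are
  therefore explicit functions.\<close>

definition is_norm :: "('a::real_vector \<Rightarrow> real) \<Rightarrow> bool" where
  "is_norm N \<longleftrightarrow>
     (\<forall>x. 0 \<le> N x) \<and>
     (\<forall>x. N x = 0 \<longleftrightarrow> x = 0) \<and>
     (\<forall>c x. N (c *\<^sub>R x) = \<bar>c\<bar> * N x) \<and>
     (\<forall>x y. N (x + y) \<le> N x + N y)"

text \<open>For a norm \<open>N\<close> on a finite-dimensional space the unit ball is compact, so this real
  supremum is a maximum.\<close>

definition dual_norm :: "('a::euclidean_space \<Rightarrow> real) \<Rightarrow> 'a \<Rightarrow> real" where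
  "dual_norm N u = (SUP x\<in>{x. N x \<le> 1}. u \<bullet> x)"

text \<open>Only used with \<open>S\<close> nonempty.\<close>

definition norm_dist :: "('a::real_vector \<Rightarrow> real) \<Rightarrow> 'a \<Rightarrow> 'a set \<Rightarrow> real" where
  "norm_dist N u S = (INF x\<in>S. N (u - x))"

definition is_maximum :: "ereal set \<Rightarrow> ereal \<Rightarrow> bool" where
  "is_maximum S M \<longleftrightarrow> M \<in> S \<and> (\<forall>s\<in>S. s \<le> M)"

text \<open>A minimum is attained, except that the minimum over the empty set is \<open>\<infinity>\<close>.\<close>

definition is_minimum :: "ereal set \<Rightarrow> ereal \<Rightarrow> bool" where
  "is_minimum S \<mu> \<longleftrightarrow> (if S = {} then \<mu> = \<infinity> else \<mu> \<in> S \<and> (\<forall>s\<in>S. \<mu> \<le> s))"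

definition pos_part :: "real ^ 'p \<Rightarrow> real ^ 'p" where
  "pos_part y = (\<chi> i. max 0 (y $ i))"

definition affine_sols :: "real ^ 'n ^ 'm \<Rightarrow> real ^ 'm \<Rightarrow> (real ^ 'n) set" where
  "affine_sols A b = {x. A *v x = b}"

text \<open>The library order \<open>\<le>\<close> on \<open>real ^ 'p\<close> is componentwise.\<close>

definition polyhedron_of :: "real ^ 'n ^ 'p \<Rightarrow> real ^ 'p \<Rightarrow> (real ^ 'n) set" where
  "polyhedron_of C d = {x. C *v x \<le> d}"

definition shifted_orthant :: "real ^ 'p \<Rightarrow> (real ^ 'p) set" where
  "shifted_orthant y = {y + s | s. 0 \<le> s}"

definition sv_map ::
    "real ^ 'n ^ 'm \<Rightarrow> real ^ 'n ^ 'p \<Rightarrow> 'p set \<Rightarrow> real ^ 'n \<Rightarrow> ((real ^ 'm) \<times> (real ^ 'p)) set" where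
  "sv_map A C J x = {(A *v x, C *v x + s) | s. \<forall>i\<in>J. 0 \<le> s $ i}"

definition sv_surjective :: "('a \<Rightarrow> 'b set) \<Rightarrow> bool" where
  "sv_surjective F \<longleftrightarrow> (\<Union>x. F x) = UNIV"

definition sv_relatively_surjective :: "('a \<Rightarrow> 'b::real_vector set) \<Rightarrow> bool" where
  "sv_relatively_surjective F \<longleftrightarrow> subspace (\<Union>x. F x)"

definition rel_surj_sets :: "real ^ 'n ^ 'm \<Rightarrow> real ^ 'n ^ 'p \<Rightarrow> 'p set set" where
  "rel_surj_sets A C = {J. sv_relatively_surjective (sv_map A C J)}"

definition feasible_J ::
    "real ^ 'n ^ 'm \<Rightarrow> real ^ 'n ^ 'p \<Rightarrow> 'p set \<Rightarrow> real ^ 'p \<Rightarrow> (real ^ 'n) set" where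
  "feasible_J A C J w = {x. A *v x = 0 \<and> (\<forall>i\<in>J. (C *v x) $ i \<le> w $ i)}"

text \<open>The minimum and the maximum that define \<open>H\<^sub>J\<close> are taken as infimum and supremum in the
  extended reals, where the infimum over the empty set is \<open>\<infinity>\<close>. That they are attained
  is asserted separately, by \<open>is_minimum\<close> and \<open>is_maximum\<close>.\<close>

definition min_norm_J ::
    "(real ^ 'n \<Rightarrow> real) \<Rightarrow> real ^ 'n ^ 'm \<Rightarrow> real ^ 'n ^ 'p \<Rightarrow> 'p set \<Rightarrow> real ^ 'p \<Rightarrow> ereal" where
  "min_norm_J N A C J w = (INF x\<in>feasible_J A C J w. ereal (N x))"

definition H_J ::
    "(real ^ 'n \<Rightarrow> real) \<Rightarrow> (real ^ 'p \<Rightarrow> real) \<Rightarrow> real ^ 'n ^ 'm \<Rightarrow> real ^ 'n ^ 'p \<Rightarrow> 'p set \<Rightarrow> ereal"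
  where
  "H_J N N' A C J = (SUP w\<in>{w. N' w \<le> 1}. min_norm_J N A C J w)"

text \<open>\<open>Max\<close> ranges over a finite set, which is nonempty since \<open>{}\<close> always belongs
  to \<open>rel_surj_sets A C\<close>.\<close>

definition hoffman_H ::
    "(real ^ 'n \<Rightarrow> real) \<Rightarrow> (real ^ 'p \<Rightarrow> real) \<Rightarrow> real ^ 'n ^ 'm \<Rightarrow> real ^ 'n ^ 'p \<Rightarrow> ereal" where
  "hoffman_H N N' A C = Max (H_J N N' A C ` rel_surj_sets A C)"

end

theory Submission imports Defs begin

text \<open>Two arguments carry the theorem: strong duality for relatively surjective
  subsystems, and a reduction of arbitrary multipliers to relatively surjective
  supports. A multiplier is a pair \<open>(v, z)\<close> with \<open>z \<ge> 0\<close>; its combination is \<open>A\<^sup>T v + C\<^sup>T z\<close>.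

  Duality. If \<open>A x = 0\<close>, \<open>C x \<le> w\<close> on \<open>J\<close> has no solution with \<open>N x \<le> r\<close>, then \<open>(0, w)\<close> can be
  separated strictly from the closed convex set of all \<open>(A x, C x + s)\<close> with \<open>N x \<le> r\<close> and \<open>s \<ge> 0\<close>
  on \<open>J\<close>. The normal is a multiplier with \<open>z\<close> supported on \<open>J\<close> and with \<open>- (z \<bullet> w) > r * t\<close>, where
  \<open>t\<close> is the dual norm of its combination (lemma \<open>bounded_solution_or_multiplier\<close>). Hence a bound
  \<open>dual_norm N' z \<le> M * t\<close> for all such multipliers yields solutions with \<open>N x \<le> M * N' w\<close>.
  Compactness of the ball makes the set to be separated closed. The bound \<open>M\<close> exists, and is attained, as soon as a vanishing
  combination forces \<open>z = 0\<close> (lemma \<open>multiplier_constant\<close>), and this condition is equivalent to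
  relative surjectivity of \<open>[A, C, J]\<close>. Weak duality shows that the best \<open>M\<close> is \<open>H\<^sub>J\<close>, which gives the
  maximum formula; the minimum formula is the same statement normalised the other way.

  Error bound. For a solvable system with right-hand side \<open>e = d - C u\<close> the separating multiplier
  may have a support that is not relatively surjective. It then admits a nonzero \<open>z'\<close>
  with vanishing combination, and solvability gives \<open>z' \<bullet> e \<ge> 0\<close>; subtracting a multiple of it shrinks the
  support without spoiling the separation (lemma \<open>multiplier_support_reduction\<close>). On
  the final support \<open>J\<close> the bound by \<open>H\<^sub>J \<le> H\<close> contradicts the separation. The bound is tight
  because an extremal \<open>w\<close> for an optimal \<open>J\<close> turns into such a \<open>d\<close> after relaxing the inequalities
  outside \<open>J\<close>. Since \<open>H\<^sub>J\<close> is monotone in \<open>J\<close>, surjectivity of the full mapping makes the whole index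
  set optimal.\<close>

section \<open>Norms and dual norms on a Euclidean space\<close>

lemma is_norm_nonneg: "is_norm N \<Longrightarrow> 0 \<le> N x"
  by (simp add: is_norm_def)

lemma is_norm_eq_0_iff: "is_norm N \<Longrightarrow> N x = 0 \<longleftrightarrow> x = 0"
  by (simp add: is_norm_def)

lemma is_norm_scaleR: "is_norm N \<Longrightarrow> N (c *\<^sub>R x) = \<bar>c\<bar> * N x"
  by (simp add: is_norm_def)

lemma is_norm_triangle: "is_norm N \<Longrightarrow> N (x + y) \<le> N x + N y"
  by (simp add: is_norm_def)

lemma is_norm_minus: "is_norm N \<Longrightarrow> N (- x) = N x"
  using is_norm_scaleR[of N "-1" x] by simp

lemma is_norm_pos: "is_norm N \<Longrightarrow> x \<noteq> 0 \<Longrightarrow> 0 < N x"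
  by (simp add: order.strict_iff_order is_norm_nonneg is_norm_eq_0_iff eq_commute[of 0])

lemma is_norm_convex_on: "is_norm N \<Longrightarrow> convex_on UNIV N"
proof (rule convex_onI)
  fix t :: real and x y assume N: "is_norm N" and t: "0 < t" "t < 1"
  have "N ((1 - t) *\<^sub>R x + t *\<^sub>R y) \<le> N ((1 - t) *\<^sub>R x) + N (t *\<^sub>R y)"
    by (rule is_norm_triangle[OF N])
  with t show "N ((1 - t) *\<^sub>R x + t *\<^sub>R y) \<le> (1 - t) * N x + t * N y"
    by (simp add: is_norm_scaleR[OF N])
qed simp

lemma is_norm_continuous_on:
  fixes N :: "'a::euclidean_space \<Rightarrow> real"
  assumes "is_norm N"
  shows "continuous_on S N"
  using convex_on_continuous[OF open_UNIV is_norm_convex_on[OF assms]]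
  by (rule continuous_on_subset) simp

lemma is_norm_lower_bound:
  fixes N :: "'a::euclidean_space \<Rightarrow> real"
  assumes N: "is_norm N"
  obtains c where "0 < c" "\<And>x. c * norm x \<le> N x"
proof -
  have "sphere (0::'a) 1 \<noteq> {}" by simp
  then obtain x0 where x0: "x0 \<in> sphere 0 1" "\<And>x. x \<in> sphere 0 1 \<Longrightarrow> N x0 \<le> N x"
    using continuous_attains_inf[OF compact_sphere _ is_norm_continuous_on[OF N]] by blast
  have "N x0 * norm x \<le> N x" for x
  proof (cases "x = 0")
    case True
    then show ?thesis using is_norm_nonneg[OF N] by simp
  next
    case False
    then have "N x0 \<le> N ((1 / norm x) *\<^sub>R x)" by (intro x0(2)) simp
    with False show ?thesis by (simp add: is_norm_scaleR[OF N] field_simps)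
  qed
  moreover have "0 < N x0" using x0(1) by (intro is_norm_pos[OF N]) auto
  ultimately show ?thesis using that by blast
qed

lemma is_norm_compact_ball:
  fixes N :: "'a::euclidean_space \<Rightarrow> real"
  assumes N: "is_norm N"
  shows "compact {x. N x \<le> r}"
proof -
  obtain c where c: "0 < c" "\<And>x. c * norm x \<le> N x" by (rule is_norm_lower_bound[OF N]) blast
  have "norm x \<le> r / c" if "N x \<le> r" for x
    using c(1) c(2)[of x] that by (simp add: field_simps)
  then have "bounded {x. N x \<le> r}" by (auto simp: bounded_iff)
  moreover have "closed {x. N x \<le> r}"
    by (intro closed_Collect_le is_norm_continuous_on[OF N] continuous_on_const)
  ultimately show ?thesis by (simp add: compact_eq_bounded_closed)
qed

lemma is_norm_convex_ball:
  assumes "is_norm N"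
  shows "convex {x. N x \<le> r}"
proof (rule convexI, unfold mem_Collect_eq)
  fix x y and s t :: real
  assume xy: "N x \<le> r" "N y \<le> r" and st: "0 \<le> s" "0 \<le> t" "s + t = 1"
  have "N (s *\<^sub>R x + t *\<^sub>R y) \<le> s * N x + t * N y"
    using is_norm_convex_on[OF assms] st by (simp add: convex_on_def)
  also have "\<dots> \<le> r" by (rule convex_bound_le[OF xy st])
  finally show "N (s *\<^sub>R x + t *\<^sub>R y) \<le> r" .
qed

text \<open>The part of \<open>S\<close> within distance \<open>N (u - x0)\<close> of \<open>u\<close> is compact, for any \<open>x0 \<in> S\<close>.\<close>

lemma is_norm_nearest_point:
  fixes N :: "'a::euclidean_space \<Rightarrow> real"
  assumes N: "is_norm N" and S: "closed S" "S \<noteq> {}"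
  obtains x where "x \<in> S" "\<And>y. y \<in> S \<Longrightarrow> N (u - x) \<le> N (u - y)"
proof -
  obtain x0 where x0: "x0 \<in> S" using S by blast
  define B where "B = (\<lambda>y. u - y) ` {y. N y \<le> N (u - x0)}"
  have B: "y \<in> B" if "N (u - y) \<le> N (u - x0)" for y
    unfolding B_def using that by (intro image_eqI[of _ _ "u - y"]) simp_all
  have "compact B" unfolding B_def
    by (intro compact_continuous_image continuous_on_diff continuous_on_const continuous_on_id
        is_norm_compact_ball[OF N])
  with S(1) have "compact (S \<inter> B)" by (rule closed_Int_compact)
  moreover have "x0 \<in> S \<inter> B" using x0 B[of x0] by simp
  then have "S \<inter> B \<noteq> {}" by blast
  moreover have "continuous_on (S \<inter> B) (\<lambda>y. N (u - y))"
    by (rule continuous_on_compose2[OF is_norm_continuous_on[OF N, of UNIV]])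
      (simp_all add: continuous_on_diff)
  ultimately obtain x where x: "x \<in> S \<inter> B" "\<forall>y\<in>S \<inter> B. N (u - x) \<le> N (u - y)"
    using continuous_attains_inf[of "S \<inter> B" "\<lambda>y. N (u - y)"] by metis
  have "N (u - x) \<le> N (u - y)" if "y \<in> S" for y
  proof (cases "N (u - y) \<le> N (u - x0)")
    case True
    with that x(2) B[of y] show ?thesis by simp
  next
    case False
    moreover have "N (u - x) \<le> N (u - x0)" using x(2) \<open>x0 \<in> S \<inter> B\<close> by (rule bspec)
    ultimately show ?thesis by linarith
  qed
  moreover have "x \<in> S" using x(1) by (rule IntD1)
  ultimately show ?thesis using that by metis
qed

lemma norm_dist_le:
  assumes "is_norm N" "x \<in> S"
  shows "norm_dist N u S \<le> N (u - x)"
  unfolding norm_dist_def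
  by (rule cINF_lower[OF bdd_belowI2[of _ 0] assms(2)]) (rule is_norm_nonneg[OF assms(1)])

lemma norm_dist_attained:
  fixes N :: "'a::euclidean_space \<Rightarrow> real"
  assumes N: "is_norm N" and S: "closed S" "S \<noteq> {}"
  obtains x where "x \<in> S" "norm_dist N u S = N (u - x)"
proof -
  obtain x where x: "x \<in> S" "\<And>y. y \<in> S \<Longrightarrow> N (u - x) \<le> N (u - y)"
    using is_norm_nearest_point[OF N S, of u] by metis
  have "N (u - x) \<le> norm_dist N u S"
    unfolding norm_dist_def by (rule cINF_greatest[OF S(2)]) (rule x(2))
  from norm_dist_le[OF N x(1)] this have "norm_dist N u S = N (u - x)" by (rule antisym)
  with x(1) show ?thesis by (rule that)
qed

lemma dual_norm_attained:
  fixes N :: "'a::euclidean_space \<Rightarrow> real"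
  assumes N: "is_norm N"
  obtains x where "N x \<le> 1" "dual_norm N u = u \<bullet> x" "\<And>y. N y \<le> 1 \<Longrightarrow> u \<bullet> y \<le> u \<bullet> x"
proof -
  have "{x. N x \<le> 1} \<noteq> {}" using is_norm_eq_0_iff[OF N, of 0] by (auto intro!: exI[of _ 0])
  moreover have "continuous_on {x. N x \<le> 1} (\<lambda>x. u \<bullet> x)" by (intro continuous_intros)
  ultimately obtain x where x: "N x \<le> 1" "\<And>y. N y \<le> 1 \<Longrightarrow> u \<bullet> y \<le> u \<bullet> x"
    using continuous_attains_sup[OF is_norm_compact_ball[OF N, of 1]] by blast
  have "dual_norm N u = u \<bullet> x"
    unfolding dual_norm_def using x by (intro cSup_eq_maximum) auto
  with x that show ?thesis by blast
qed

lemma inner_le_dual_norm: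
  fixes N :: "'a::euclidean_space \<Rightarrow> real"
  assumes N: "is_norm N"
  shows "u \<bullet> x \<le> dual_norm N u * N x"
proof (cases "x = 0")
  case True
  then show ?thesis using is_norm_eq_0_iff[OF N, of 0] by simp
next
  case False
  then have pos: "0 < N x" by (rule is_norm_pos[OF N])
  obtain y where y: "dual_norm N u = u \<bullet> y" "\<And>y'. N y' \<le> 1 \<Longrightarrow> u \<bullet> y' \<le> u \<bullet> y"
    by (rule dual_norm_attained[OF N]) blast
  have "u \<bullet> ((1 / N x) *\<^sub>R x) \<le> dual_norm N u"
    unfolding y(1) using pos by (intro y(2)) (simp add: is_norm_scaleR[OF N])
  with pos show ?thesis by (simp add: field_simps)
qed

lemma is_norm_dual_norm:
  fixes N :: "'a::euclidean_space \<Rightarrow> real"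
  assumes N: "is_norm N"
  shows "is_norm (dual_norm N)"
proof -
  have le: "u \<bullet> x \<le> dual_norm N u" if "N x \<le> 1" for u x
    using dual_norm_attained[OF N, of u] that by metis
  have ex: "\<exists>x. N x \<le> 1 \<and> dual_norm N u = u \<bullet> x" for u
    using dual_norm_attained[OF N, of u] by metis
  have N0: "N 0 = 0" using is_norm_eq_0_iff[OF N] by simp
  have nonneg: "0 \<le> dual_norm N u" for u
    using le[of 0 u] N0 by simp
  have "u = 0" if "dual_norm N u = 0" for u
    using inner_le_dual_norm[OF N, of u u] that inner_eq_zero_iff[of u] inner_ge_zero[of u] by simp
  moreover have "dual_norm N 0 = 0" using ex[of 0] by auto
  moreover have tri: "dual_norm N (u + v) \<le> dual_norm N u + dual_norm N v" for u v
  proof -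
    obtain x where x: "N x \<le> 1" "dual_norm N (u + v) = (u + v) \<bullet> x" using ex by blast
    from le[OF x(1), of u] le[OF x(1), of v] show ?thesis by (simp add: x(2) inner_add_left)
  qed
  moreover have sc: "dual_norm N (c *\<^sub>R u) \<le> \<bar>c\<bar> * dual_norm N u" for c u
  proof -
    obtain x where x: "N x \<le> 1" "dual_norm N (c *\<^sub>R u) = c *\<^sub>R u \<bullet> x" using ex by blast
    have "u \<bullet> x \<le> dual_norm N u" "u \<bullet> (- x) \<le> dual_norm N u"
      using x(1) by (auto intro!: le simp only: is_norm_minus[OF N])
    then have "\<bar>u \<bullet> x\<bar> \<le> dual_norm N u" by simp
    then have "\<bar>c\<bar> * \<bar>u \<bullet> x\<bar> \<le> \<bar>c\<bar> * dual_norm N u" by (rule mult_left_mono) simp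
    moreover have "c * (u \<bullet> x) \<le> \<bar>c\<bar> * \<bar>u \<bullet> x\<bar>" by (simp flip: abs_mult)
    ultimately show ?thesis using x(2) by simp
  qed
  moreover have "\<bar>c\<bar> * dual_norm N u \<le> dual_norm N (c *\<^sub>R u)" for c u
  proof (cases "c = 0")
    case True
    then show ?thesis using nonneg by simp
  next
    case False
    then show ?thesis using sc[of "1 / c" "c *\<^sub>R u"] by (simp add: field_simps)
  qed
  ultimately show ?thesis
    unfolding is_norm_def using nonneg by (intro conjI allI) (blast intro: order_antisym)+
qed

section \<open>Multipliers and relative surjectivity\<close>

definition adjoint_comb :: "real ^ 'n ^ 'm \<Rightarrow> real ^ 'n ^ 'p \<Rightarrow> real ^ 'm \<Rightarrow> real ^ 'p \<Rightarrow> real ^ 'n" where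
  "adjoint_comb A C v z = transpose A *v v + transpose C *v z"

lemma adjoint_comb_inner: "adjoint_comb A C v z \<bullet> x = v \<bullet> (A *v x) + z \<bullet> (C *v x)"
  by (simp add: adjoint_comb_def inner_add_left dot_lmul_matrix flip: vector_transpose_matrix)

lemma adjoint_comb_scaleR:
  "adjoint_comb A C (c *\<^sub>R v) (c *\<^sub>R z) = c *\<^sub>R adjoint_comb A C v z"
  by (simp add: adjoint_comb_def matrix_vector_mult_scaleR scaleR_add_right)

lemma adjoint_comb_diff:
  "adjoint_comb A C (v - v') (z - z') = adjoint_comb A C v z - adjoint_comb A C v' z'"
  by (simp add: adjoint_comb_def matrix_vector_mult_diff_distrib)

definition orthant_face :: "'p set \<Rightarrow> (real ^ 'p) set" where
  "orthant_face J = {z. 0 \<le> z \<and> (\<forall>i\<in>- J. z $ i = 0)}"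

lemma zero_in_orthant_face: "0 \<in> orthant_face J"
  by (simp add: orthant_face_def)

lemma orthant_face_scaleR: "z \<in> orthant_face J \<Longrightarrow> 0 \<le> c \<Longrightarrow> c *\<^sub>R z \<in> orthant_face J"
  by (simp add: orthant_face_def less_eq_vec_def)

lemma orthant_face_inner_le:
  assumes "z \<in> orthant_face J" "\<And>i. i \<in> J \<Longrightarrow> x $ i \<le> y $ i"
  shows "z \<bullet> x \<le> z \<bullet> y"
  unfolding inner_vec_def
proof (rule sum_mono)
  fix i
  show "z $ i \<bullet> x $ i \<le> z $ i \<bullet> y $ i"
    using assms by (cases "i \<in> J") (auto simp: orthant_face_def less_eq_vec_def mult_left_mono)
qed

text \<open>The pairs \<open>(v, z)\<close> with \<open>z\<close> in the face and vanishing combination form, up to sign, the polar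
  cone of the range of \<open>[A, C, J]\<close>. A closed convex cone is a subspace iff its polar is one, and as
  \<open>z \<ge> 0\<close> throughout, the polar is a subspace iff \<open>z = 0\<close> throughout: this is the dual form of relative
  surjectivity.\<close>

definition trivial_kernel :: "real ^ 'n ^ 'm \<Rightarrow> real ^ 'n ^ 'p \<Rightarrow> 'p set \<Rightarrow> bool" where
  "trivial_kernel A C J \<longleftrightarrow> (\<forall>v. \<forall>z\<in>orthant_face J. adjoint_comb A C v z = 0 \<longrightarrow> z = 0)"

text \<open>The part of \<open>v\<close> orthogonal to the range of \<open>A\<close> lies in the kernel of the transpose, so it
  can be dropped without changing the combination.\<close>

lemma adjoint_comb_range:
  fixes A :: "real ^ 'n ^ 'm"
  obtains v' where "v' \<in> range ((*v) A)" "\<And>z. adjoint_comb A C v' z = adjoint_comb A C v z"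
proof -
  have span: "span (range ((*v) A)) = range ((*v) A)"
    by (intro span_eq_iff[THEN iffD2] linear_subspace_image subspace_UNIV) simp
  obtain y y' where y: "y \<in> range ((*v) A)" "\<And>w. w \<in> range ((*v) A) \<Longrightarrow> orthogonal y' w" "v = y + y'"
    using orthogonal_subspace_decomp_exists[of "range ((*v) A)" v] unfolding span by metis
  have "adjoint_comb A C y z = adjoint_comb A C v z" for z
  proof (rule vector_eq_ldot[THEN iffD1], rule allI)
    fix x
    have "y' \<bullet> (A *v x) = 0" using y(2) by (auto simp: orthogonal_def)
    then show "x \<bullet> adjoint_comb A C y z = x \<bullet> adjoint_comb A C v z"
      by (simp add: inner_commute[of x] adjoint_comb_inner y(3) inner_add_left)
  qed
  with y(1) that show ?thesis by blast
qed

text \<open>Restricting \<open>v\<close> to the range of \<open>A\<close> removes the remaining kernel, so the combination is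
  bounded below on the unit sphere of a closed cone; its sublevel set is then compact, which
  yields an extremal pair. The bound extends to all \<open>v\<close> by projection.\<close>

lemma multiplier_constant:
  fixes A :: "real ^ 'n ^ 'm" and C :: "real ^ 'n ^ 'p"
  assumes N: "is_norm N" and N': "is_norm N'" and J: "trivial_kernel A C J"
  obtains v0 z0 where "v0 \<in> range ((*v) A)" "z0 \<in> orthant_face J"
    "dual_norm N (adjoint_comb A C v0 z0) \<le> 1"
    "\<And>v z. z \<in> orthant_face J \<Longrightarrow>
       dual_norm N' z \<le> dual_norm N' z0 * dual_norm N (adjoint_comb A C v z)"
proof -
  define K where "K = range ((*v) A) \<times> orthant_face J"
  define g where "g = (\<lambda>p. dual_norm N (adjoint_comb A C (fst p) (snd p)))"
  note dN = is_norm_dual_norm[OF N] and dN' = is_norm_dual_norm[OF N']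
  have g_scale: "g (c *\<^sub>R p) = \<bar>c\<bar> * g p" for c p
    by (simp add: g_def adjoint_comb_scaleR is_norm_scaleR[OF dN])
  have K_scale: "c *\<^sub>R p \<in> K" if "p \<in> K" "0 \<le> c" for c p
    using that unfolding K_def mem_Times_iff
    by (auto simp: orthant_face_scaleR intro!: image_eqI[of _ _ "c *\<^sub>R _"] simp flip: matrix_vector_mult_scaleR)
  have g_cont: "continuous_on S g" for S
    unfolding g_def adjoint_comb_def
    by (intro continuous_on_compose2[OF is_norm_continuous_on[OF dN, of UNIV]] continuous_intros
        linear_continuous_on_compose[OF _ matrix_vector_mul_linear]) auto
  have "closed (range ((*v) A))"
    by (intro closed_subspace linear_subspace_image subspace_UNIV) simp
  moreover have "closed (orthant_face J)"
    unfolding orthant_face_def less_eq_vec_def Ball_def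
    by (intro closed_Collect_conj closed_Collect_all closed_Collect_imp closed_Collect_le
        closed_Collect_eq continuous_intros) auto
  ultimately have K_closed: "closed K" unfolding K_def by (rule closed_Times)
  have K0: "0 \<in> K"
    by (auto simp: K_def zero_prod_def zero_in_orthant_face intro!: image_eqI[of _ _ 0])
  have g_pos: "0 < g p" if "p \<in> K" "p \<noteq> 0" for p
  proof -
    obtain v z where p: "p = (v, z)" by force
    have "v \<in> range ((*v) A)" and z: "z \<in> orthant_face J" using that by (auto simp: K_def p)
    then obtain x where x: "v = A *v x" by blast
    have "adjoint_comb A C v z \<noteq> 0"
    proof
      assume eq: "adjoint_comb A C v z = 0"
      with J z have "z = 0" unfolding trivial_kernel_def by blast
      with eq have "v \<bullet> (A *v x) = 0" using adjoint_comb_inner[of A C v z x] by simp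
      with x \<open>z = 0\<close> that(2) show False by (simp add: p zero_prod_def)
    qed
    then show ?thesis unfolding g_def p by (simp add: is_norm_pos[OF dN])
  qed
  obtain c where c: "0 < c" "\<And>p. p \<in> K \<Longrightarrow> c * norm p \<le> g p"
  proof (cases "K \<inter> sphere 0 1 = {}")
    case True
    have "p = 0" if "p \<in> K" for p
    proof (rule ccontr)
      assume "p \<noteq> 0"
      then have "(1 / norm p) *\<^sub>R p \<in> K \<inter> sphere 0 1" using K_scale[OF that] by simp
      with True show False by blast
    qed
    then have "1 * norm p \<le> g p" if "p \<in> K" for p
      using \<open>p \<in> K \<Longrightarrow> p = 0\<close>[OF that] is_norm_nonneg[OF dN] by (auto simp: g_def)
    then show ?thesis by (rule that[OF zero_less_one])
  next
    case False
    have "compact (K \<inter> sphere 0 1)" using K_closed by (intro closed_Int_compact) auto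
    then obtain q where q: "q \<in> K \<inter> sphere 0 1" "\<And>p. p \<in> K \<inter> sphere 0 1 \<Longrightarrow> g q \<le> g p"
      using continuous_attains_inf[OF _ False g_cont] by blast
    show ?thesis
    proof (rule that[of "g q"])
      show "0 < g q" using q(1) by (intro g_pos) auto
      fix p assume p: "p \<in> K"
      show "g q * norm p \<le> g p"
      proof (cases "p = 0")
        case True
        then show ?thesis by (simp add: g_def is_norm_nonneg[OF dN])
      next
        case False
        then have "g q \<le> g ((1 / norm p) *\<^sub>R p)" using K_scale[OF p] by (intro q(2)) simp
        with False show ?thesis by (simp add: g_scale field_simps)
      qed
    qed
  qed
  define D where "D = K \<inter> {p. g p \<le> 1}"
  have "norm p \<le> 1 / c" if "p \<in> D" for p
    using c(1) c(2)[of p] that by (simp add: D_def field_simps)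
  then have "bounded D" unfolding bounded_iff by blast
  moreover have "closed D"
    unfolding D_def by (intro closed_Int K_closed closed_Collect_le g_cont continuous_on_const)
  ultimately have "compact D" by (simp add: compact_eq_bounded_closed)
  moreover have D0: "0 \<in> D"
    using K0 g_scale[of 0 0] by (simp add: D_def)
  moreover have "continuous_on D (\<lambda>p. dual_norm N' (snd p))"
    by (intro continuous_on_compose2[OF is_norm_continuous_on[OF dN', of UNIV]] continuous_intros) auto
  ultimately obtain p0 where p0: "p0 \<in> D" "\<And>p. p \<in> D \<Longrightarrow> dual_norm N' (snd p) \<le> dual_norm N' (snd p0)"
    using continuous_attains_sup[of D "\<lambda>p. dual_norm N' (snd p)"] by blast
  show ?thesis
  proof (rule that[of "fst p0" "snd p0"])
    show "fst p0 \<in> range ((*v) A)" "snd p0 \<in> orthant_face J"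
      "dual_norm N (adjoint_comb A C (fst p0) (snd p0)) \<le> 1"
      using p0(1) by (auto simp: D_def K_def g_def)
    fix v z assume z: "z \<in> orthant_face J"
    obtain v' where v': "v' \<in> range ((*v) A)" "\<And>z. adjoint_comb A C v' z = adjoint_comb A C v z"
      by (rule adjoint_comb_range) blast
    have p: "(v', z) \<in> K" using v' z by (simp add: K_def)
    have "dual_norm N' z \<le> dual_norm N' (snd p0) * g (v', z)"
    proof (cases "(v', z) = 0")
      case True
      moreover have "dual_norm N' 0 = 0" by (simp add: is_norm_eq_0_iff[OF dN'])
      ultimately show ?thesis
        using is_norm_nonneg[OF dN'] is_norm_nonneg[OF dN] by (simp add: zero_prod_def g_def)
    next
      case False
      then have pos: "0 < g (v', z)" by (rule g_pos[OF p])
      then have "(1 / g (v', z)) *\<^sub>R (v', z) \<in> D"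
        unfolding D_def using K_scale[OF p, of "1 / g (v', z)"] g_scale[of "1 / g (v', z)" "(v', z)"] by simp
      from p0(2)[OF this] pos show ?thesis by (simp add: is_norm_scaleR[OF dN'] field_simps)
    qed
    then show "dual_norm N' z \<le> dual_norm N' (snd p0) * dual_norm N (adjoint_comb A C v z)"
      by (simp add: g_def v'(2))
  qed
qed

text \<open>The system fails to have a solution in the ball of radius \<open>r\<close> exactly when \<open>(0, w)\<close> misses
  the closed convex set of all \<open>(A x, C x + s)\<close> with \<open>N x \<le> r\<close> and \<open>s\<close> nonnegative on \<open>J\<close>. The
  normal of a strictly separating hyperplane is the pair of multipliers: the recession directions
  \<open>s\<close> force \<open>z\<close> into the face of the orthant, and minimising over the ball produces the dual
  norm.\<close>

lemma bounded_solution_or_multiplier: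
  fixes A :: "real ^ 'n ^ 'm" and C :: "real ^ 'n ^ 'p"
  assumes N: "is_norm N" and r: "0 \<le> r"
    and none: "\<And>x. x \<in> feasible_J A C J w \<Longrightarrow> r < N x"
  obtains v z where "z \<in> orthant_face J" "z \<bullet> w < - (r * dual_norm N (adjoint_comb A C v z))"
proof -
  define F where "F = (\<lambda>x. (A *v x, C *v x)) ` {x. N x \<le> r}"
  define G where "G = ({0} :: (real ^ 'm) set) \<times> {s :: real ^ 'p. \<forall>i\<in>J. 0 \<le> s $ i}"
  define E where "E = (\<Union>x\<in>F. \<Union>y\<in>G. {x + y})"
  have lin: "linear (\<lambda>x. (A *v x, C *v x))"
    by (rule linearI) (simp_all add: matrix_vector_right_distrib matrix_vector_mult_scaleR)
  have "compact F" unfolding F_def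
    by (intro compact_continuous_image linear_continuous_on is_norm_compact_ball[OF N])
      (use lin linear_conv_bounded_linear in blast)
  moreover have "closed G" unfolding G_def Ball_def
    by (intro closed_Times closed_Collect_all closed_Collect_imp closed_Collect_le continuous_intros) auto
  ultimately have "closed E" unfolding E_def by (rule compact_closed_sums)
  have "convex F" unfolding F_def by (intro convex_linear_image[OF lin] is_norm_convex_ball[OF N])
  moreover have "convex G" unfolding G_def by (intro convex_Times) (auto simp: convex_def)
  ultimately have "convex E" unfolding E_def by (rule convex_sums)
  have E_mem: "(A *v x, C *v x + s) \<in> E" if "N x \<le> r" "\<And>i. i \<in> J \<Longrightarrow> 0 \<le> s $ i" for x s
  proof -
    have "(A *v x, C *v x) + (0, s) \<in> E" unfolding E_def F_def G_def using that by blast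
    then show ?thesis by simp
  qed
  have "(0, w) \<notin> E"
  proof
    assume "(0, w) \<in> E"
    then obtain x s where x: "N x \<le> r" "A *v x = 0" "w = C *v x + s" "\<forall>i\<in>J. 0 \<le> s $ i"
      unfolding E_def F_def G_def by auto
    then have "x \<in> feasible_J A C J w" by (simp add: feasible_J_def)
    with none x(1) show False by force
  qed
  then obtain a b where ab: "a \<bullet> (0, w) < b" "\<And>e. e \<in> E \<Longrightarrow> b < a \<bullet> e"
    using separating_hyperplane_closed_point[OF \<open>convex E\<close> \<open>closed E\<close>] by blast
  obtain v z where a: "a = (v, z)" by force
  have sep: "b < adjoint_comb A C v z \<bullet> x + z \<bullet> s"
    if "N x \<le> r" "\<And>i. i \<in> J \<Longrightarrow> 0 \<le> s $ i" for x s
    using ab(2)[OF E_mem[OF that]] by (simp add: a adjoint_comb_inner inner_add_right)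
  have N0: "N 0 \<le> r" using is_norm_eq_0_iff[OF N, of 0] r by simp
  have b: "b < 0" using sep[OF N0, of 0] by simp
  \<comment> \<open>Along \<open>s = k e\<^sub>i\<close> the separated side is unbounded below unless \<open>z\<^sub>i\<close> has the right sign;
    \<open>k = b / z\<^sub>i\<close> is where the inequality breaks.\<close>
  have axis: "b < z $ i * k" if "i \<in> J \<Longrightarrow> 0 \<le> k" for i k
  proof -
    have "0 \<le> axis i k $ j" if "j \<in> J" for j
      using that \<open>i \<in> J \<Longrightarrow> 0 \<le> k\<close> by (auto simp: axis_def)
    from sep[OF N0 this] show ?thesis by (simp add: inner_axis)
  qed
  have z: "z \<in> orthant_face J"
    unfolding orthant_face_def less_eq_vec_def
  proof (intro CollectI conjI allI ballI)
    fix i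
    show "0 $ i \<le> z $ i"
    proof (rule ccontr)
      assume "\<not> 0 $ i \<le> z $ i"
      then show False using axis[of i "b / z $ i"] b by (simp add: divide_nonpos_neg)
    qed
  next
    fix i assume "i \<in> - J"
    then show "z $ i = 0" using axis[of i "b / z $ i"] by (cases "z $ i = 0") auto
  qed
  obtain x where x: "N x \<le> 1" "dual_norm N (adjoint_comb A C v z) = adjoint_comb A C v z \<bullet> x"
    by (rule dual_norm_attained[OF N]) blast
  have "N ((- r) *\<^sub>R x) \<le> r"
    unfolding is_norm_scaleR[OF N] using x(1) r mult_left_le[of "N x" r] by simp
  from sep[OF this, of 0] x(2) have "b < - (r * dual_norm N (adjoint_comb A C v z))" by simp
  with ab(1) z that[of z v] show ?thesis by (simp add: a)
qed

text \<open>A bound on multipliers is a bound on solutions: a pair of multipliers separating \<open>(0, w)\<close>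
  would satisfy \<open>- (z \<bullet> w) > M * N' w * t\<close>, where \<open>t\<close> is the dual norm of its
  combination, against \<open>- (z \<bullet> w) \<le> dual_norm N' z * N' w\<close>.\<close>

lemma bounded_solution_of_multiplier_bound:
  fixes A :: "real ^ 'n ^ 'm" and C :: "real ^ 'n ^ 'p"
  assumes N: "is_norm N" and N': "is_norm N'" and M: "0 \<le> M"
    and bound: "\<And>v z. z \<in> orthant_face J \<Longrightarrow>
       dual_norm N' z \<le> M * dual_norm N (adjoint_comb A C v z)"
  obtains x where "x \<in> feasible_J A C J w" "N x \<le> M * N' w"
proof (rule ccontr)
  assume "\<not> thesis"
  then have none: "M * N' w < N x" if "x \<in> feasible_J A C J w" for x
    using \<open>\<And>x. x \<in> feasible_J A C J w \<Longrightarrow> N x \<le> M * N' w \<Longrightarrow> thesis\<close> that by force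
  have "0 \<le> M * N' w" using M is_norm_nonneg[OF N'] by simp
  from bounded_solution_or_multiplier[OF N this none] obtain v z where z: "z \<in> orthant_face J"
    and sep: "z \<bullet> w < - (M * N' w * dual_norm N (adjoint_comb A C v z))" by metis
  have "- (z \<bullet> w) \<le> dual_norm N' z * N' w"
    using inner_le_dual_norm[OF N', of z "- w"] by (simp add: is_norm_minus[OF N'])
  also have "\<dots> \<le> M * dual_norm N (adjoint_comb A C v z) * N' w"
    by (intro mult_right_mono bound z is_norm_nonneg[OF N'])
  finally show False using sep by (simp add: mult.assoc mult.left_commute mult.commute)
qed

text \<open>If \<open>[A, C, J]\<close> is relatively surjective, the subspace contains \<open>(0, s)\<close> and hence \<open>(0, -s)\<close>
  for \<open>s \<ge> 0\<close>; solving \<open>C x \<le> - z\<close> on \<open>J\<close> then gives \<open>z \<bullet> z \<le> 0\<close> for every \<open>z\<close> in the kernel.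
  Conversely a trivial kernel makes \<open>A x = 0\<close>, \<open>C x \<le> w\<close> on \<open>J\<close> solvable for every \<open>w\<close>, and the
  range of \<open>[A, C, J]\<close> is then the product of the range of \<open>A\<close> with the whole second factor.\<close>

lemma rel_surj_sets_iff_trivial_kernel:
  fixes A :: "real ^ 'n ^ 'm" and C :: "real ^ 'n ^ 'p"
  shows "J \<in> rel_surj_sets A C \<longleftrightarrow> trivial_kernel A C J"
proof
  assume "J \<in> rel_surj_sets A C"
  then have sub: "subspace (\<Union>x. sv_map A C J x)"
    by (simp add: rel_surj_sets_def sv_relatively_surjective_def)
  show "trivial_kernel A C J" unfolding trivial_kernel_def
  proof (intro allI ballI impI)
    fix v z assume z: "z \<in> orthant_face J" and eq: "adjoint_comb A C v z = 0"
    have "(0, z) \<in> sv_map A C J 0"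
      using z by (auto simp: sv_map_def orthant_face_def less_eq_vec_def intro!: exI[of _ z])
    then have "(0, z) \<in> (\<Union>x. sv_map A C J x)" by blast
    from subspace_neg[OF sub this] obtain x s where x: "A *v x = 0" "- z = C *v x + s" "\<forall>i\<in>J. 0 \<le> s $ i"
      by (auto simp: sv_map_def)
    have "z \<bullet> 0 \<le> z \<bullet> s" by (rule orthant_face_inner_le[OF z]) (use x in auto)
    moreover have "z \<bullet> (C *v x) = 0" using adjoint_comb_inner[of A C v z x] eq x(1) by simp
    moreover have "- (z \<bullet> z) = z \<bullet> (C *v x) + z \<bullet> s"
      using x(2) by (metis inner_add_right inner_minus_right)
    ultimately have "z \<bullet> z \<le> 0" by simp
    then show "z = 0" using inner_eq_zero_iff[of z] inner_ge_zero[of z] by simp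
  qed
next
  assume J: "trivial_kernel A C J"
  let ?norm_n = "norm :: real ^ 'n \<Rightarrow> real" and ?norm_p = "norm :: real ^ 'p \<Rightarrow> real"
  have N: "is_norm ?norm_n" "is_norm ?norm_p"
    by (auto simp: is_norm_def norm_triangle_ineq)
  obtain z0 :: "real ^ 'p" where bound: "\<And>v z. z \<in> orthant_face J \<Longrightarrow>
      dual_norm norm z \<le> dual_norm norm z0 * dual_norm norm (adjoint_comb A C v z)"
    using multiplier_constant[OF N J] by metis
  have M: "0 \<le> dual_norm ?norm_p z0" by (rule is_norm_nonneg[OF is_norm_dual_norm[OF N(2)]])
  have solvable: "\<exists>x. x \<in> feasible_J A C J w" for w
    by (rule bounded_solution_of_multiplier_bound[OF N M bound, where w = w]) blast+
  have "(\<Union>x. sv_map A C J x) = range ((*v) A) \<times> UNIV"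
  proof (intro equalityI subsetI)
    fix p assume "p \<in> range ((*v) A) \<times> (UNIV :: (real ^ 'p) set)"
    then obtain x y where p: "p = (A *v x, y)" by auto
    obtain x' where x': "x' \<in> feasible_J A C J (y - C *v x)" using solvable by blast
    have "p \<in> sv_map A C J (x + x')"
      using x' unfolding p sv_map_def feasible_J_def
      by (auto simp: matrix_vector_right_distrib algebra_simps intro!: exI[of _ "y - C *v x - C *v x'"])
    then show "p \<in> (\<Union>x. sv_map A C J x)" by blast
  qed (auto simp: sv_map_def)
  moreover have "subspace (range ((*v) A) \<times> (UNIV :: (real ^ 'p) set))"
    by (intro subspace_Times linear_subspace_image subspace_UNIV) simp
  ultimately show "J \<in> rel_surj_sets A C"
    by (simp add: rel_surj_sets_def sv_relatively_surjective_def)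
qed

section \<open>The constants of the relatively surjective subsystems\<close>

lemma closed_feasible_J: "closed (feasible_J A C J w)"
proof -
  have "closed {x. A *v x = 0 \<and> (\<forall>i. i \<in> J \<longrightarrow> (C *v x) $ i \<le> w $ i)}"
    by (intro closed_Collect_conj closed_Collect_all closed_Collect_imp closed_Collect_le
        closed_Collect_eq continuous_intros linear_continuous_on_compose[OF _ matrix_vector_mul_linear]) auto
  then show ?thesis by (simp add: feasible_J_def Ball_def)
qed

lemma min_norm_J_attained:
  assumes N: "is_norm N" and ne: "feasible_J A C J w \<noteq> {}"
  obtains x where "x \<in> feasible_J A C J w" "min_norm_J N A C J w = ereal (N x)"
    "\<And>y. y \<in> feasible_J A C J w \<Longrightarrow> N x \<le> N y"
proof -
  obtain x where x: "x \<in> feasible_J A C J w" "\<And>y. y \<in> feasible_J A C J w \<Longrightarrow> N (0 - x) \<le> N (0 - y)"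
    using is_norm_nearest_point[OF N closed_feasible_J ne, of 0] by metis
  then have le: "\<And>y. y \<in> feasible_J A C J w \<Longrightarrow> N x \<le> N y" by (simp add: is_norm_minus[OF N])
  then have "min_norm_J N A C J w = ereal (N x)"
    unfolding min_norm_J_def using x(1) by (intro INF_eqI) auto
  with x(1) le that show ?thesis by blast
qed

text \<open>Weak duality: testing \<open>C x \<le> w\<close> against multipliers bounds the norm of every feasible point
  from below by \<open>- (z \<bullet> w)\<close>. Choosing \<open>- w\<close> to be a point of the unit ball where \<open>z\<close> attains its
  dual norm makes that bound equal to \<open>dual_norm N' z\<close>.\<close>

lemma multiplier_lower_bound:
  assumes N: "is_norm N" and N': "is_norm N'" and z: "z \<in> orthant_face J"
    and le1: "dual_norm N (adjoint_comb A C v z) \<le> 1"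
  obtains w where "N' w \<le> 1" "\<And>x. x \<in> feasible_J A C J w \<Longrightarrow> dual_norm N' z \<le> N x"
proof -
  obtain y where y: "N' y \<le> 1" "dual_norm N' z = z \<bullet> y"
    by (rule dual_norm_attained[OF N']) blast
  have "dual_norm N' z \<le> N x" if x: "x \<in> feasible_J A C J (- y)" for x
  proof -
    have "z \<bullet> (C *v x) \<le> z \<bullet> (- y)"
      using x by (intro orthant_face_inner_le[OF z]) (simp add: feasible_J_def)
    then have "dual_norm N' z \<le> adjoint_comb A C v z \<bullet> (- x)"
      using x y(2) adjoint_comb_inner[of A C v z x] by (simp add: feasible_J_def)
    also have "\<dots> \<le> dual_norm N (adjoint_comb A C v z) * N (- x)" by (rule inner_le_dual_norm[OF N])
    also have "\<dots> \<le> N x"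
      using le1 is_norm_nonneg[OF N, of x] mult_right_mono[OF le1] by (simp add: is_norm_minus[OF N])
    finally show ?thesis .
  qed
  with y(1) that[of "- y"] show ?thesis by (simp add: is_norm_minus[OF N'])
qed

text \<open>All the information about \<open>H\<^sub>J\<close> used below: it is a real number, the best bound for the
  multipliers supported on \<open>J\<close>, and it is attained on the primal and on the dual side. The two
  sides agree by strong duality: the multiplier bound yields small solutions by separation, and
  the extremal multipliers yield a right-hand side without smaller ones.\<close>

lemma H_J_attained:
  fixes A :: "real ^ 'n ^ 'm" and C :: "real ^ 'n ^ 'p"
  assumes N: "is_norm N" and N': "is_norm N'" and J: "J \<in> rel_surj_sets A C"
  obtains M v0 z0 w0 where "H_J N N' A C J = ereal M" "0 \<le> M"
    "\<And>w. feasible_J A C J w \<noteq> {}"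
    "N' w0 \<le> 1" "min_norm_J N A C J w0 = ereal M"
    "v0 \<in> range ((*v) A)" "z0 \<in> orthant_face J" "dual_norm N' z0 = M"
    "dual_norm N (adjoint_comb A C v0 z0) \<le> 1"
    "\<And>v z. z \<in> orthant_face J \<Longrightarrow> dual_norm N' z \<le> M * dual_norm N (adjoint_comb A C v z)"
proof -
  obtain v0 z0 where v0: "v0 \<in> range ((*v) A)" and z0: "z0 \<in> orthant_face J"
    and le1: "dual_norm N (adjoint_comb A C v0 z0) \<le> 1"
    and bound: "\<And>v z. z \<in> orthant_face J \<Longrightarrow>
      dual_norm N' z \<le> dual_norm N' z0 * dual_norm N (adjoint_comb A C v z)"
    using multiplier_constant[OF N N' J[unfolded rel_surj_sets_iff_trivial_kernel]] by metis
  define M where "M = dual_norm N' z0"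
  note bound = bound[folded M_def]
  have M: "0 \<le> M" unfolding M_def by (rule is_norm_nonneg[OF is_norm_dual_norm[OF N']])
  have sol: "\<exists>x\<in>feasible_J A C J w. N x \<le> M * N' w" for w
    by (rule bounded_solution_of_multiplier_bound[OF N N' M bound, where w = w]) blast+
  then have ne: "feasible_J A C J w \<noteq> {}" for w by blast
  have upper: "min_norm_J N A C J w \<le> ereal M" if "N' w \<le> 1" for w
  proof -
    obtain x where x: "x \<in> feasible_J A C J w" "N x \<le> M * N' w" using sol by blast
    have "M * N' w \<le> M" using that M by (simp add: mult_left_le)
    with x show ?thesis unfolding min_norm_J_def by (intro INF_lower2[OF x(1)]) simp
  qed
  obtain w0 where w0: "N' w0 \<le> 1" "\<And>x. x \<in> feasible_J A C J w0 \<Longrightarrow> M \<le> N x"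
    unfolding M_def using multiplier_lower_bound[OF N N' z0 le1] by metis
  have "ereal M \<le> min_norm_J N A C J w0"
    unfolding min_norm_J_def using w0(2) by (intro INF_greatest) simp
  with upper[OF w0(1)] have eq: "min_norm_J N A C J w0 = ereal M" by (rule antisym)
  have "H_J N N' A C J = ereal M"
    unfolding H_J_def
  proof (rule SUP_eqI)
    show "min_norm_J N A C J w \<le> ereal M" if "w \<in> {w. N' w \<le> 1}" for w using upper that by blast
    show "ereal M \<le> y" if "\<And>w. w \<in> {w. N' w \<le> 1} \<Longrightarrow> min_norm_J N A C J w \<le> y" for y
      using that[of w0] w0(1) eq by simp
  qed
  then show ?thesis
    using M ne w0(1) eq v0 z0 M_def[symmetric] le1 bound by (rule that)
qed

lemma H_J_primal_attained:
  assumes N: "is_norm N" and N': "is_norm N'" and J: "J \<in> rel_surj_sets A C"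
  shows "is_minimum ((\<lambda>x. ereal (N x)) ` feasible_J A C J w) (min_norm_J N A C J w)"
    and "is_maximum (min_norm_J N A C J ` {w. N' w \<le> 1}) (H_J N N' A C J)"
proof -
  obtain M w0 where H: "H_J N N' A C J = ereal M" and ne: "\<And>w. feasible_J A C J w \<noteq> {}"
    and w0: "N' w0 \<le> 1" "min_norm_J N A C J w0 = ereal M"
    by (rule H_J_attained[OF N N' J]) blast
  obtain x where "x \<in> feasible_J A C J w" "min_norm_J N A C J w = ereal (N x)"
    "\<And>y. y \<in> feasible_J A C J w \<Longrightarrow> N x \<le> N y"
    using min_norm_J_attained[OF N ne] by metis
  then show "is_minimum ((\<lambda>x. ereal (N x)) ` feasible_J A C J w) (min_norm_J N A C J w)"
    by (auto simp: is_minimum_def)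
  have "H_J N N' A C J \<in> min_norm_J N A C J ` {w. N' w \<le> 1}"
    using w0 H by (intro image_eqI[of _ _ w0]) auto
  then show "is_maximum (min_norm_J N A C J ` {w. N' w \<le> 1}) (H_J N N' A C J)"
    by (auto simp: is_maximum_def H_J_def intro!: SUP_upper)
qed

lemma H_J_dual_maximum:
  assumes N: "is_norm N" and N': "is_norm N'" and J: "J \<in> rel_surj_sets A C"
  shows "is_maximum
    {ereal (dual_norm N' z) | v z.
       v \<in> range ((*v) A) \<and> z \<in> orthant_face J \<and> dual_norm N (adjoint_comb A C v z) \<le> 1}
    (H_J N N' A C J)"
proof -
  obtain M v0 z0 where H: "H_J N N' A C J = ereal M" "0 \<le> M"
    and p0: "v0 \<in> range ((*v) A)" "z0 \<in> orthant_face J" "dual_norm N' z0 = M"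
      "dual_norm N (adjoint_comb A C v0 z0) \<le> 1"
    and bound: "\<And>v z. z \<in> orthant_face J \<Longrightarrow> dual_norm N' z \<le> M * dual_norm N (adjoint_comb A C v z)"
    by (rule H_J_attained[OF N N' J]) blast
  have "dual_norm N' z \<le> M" if "z \<in> orthant_face J" "dual_norm N (adjoint_comb A C v z) \<le> 1" for v z
    using bound[OF that(1), of v] mult_left_le[OF that(2) H(2)] by linarith
  with H(1) p0 show ?thesis by (fastforce simp: is_maximum_def)
qed

text \<open>By homogeneity the ratio of \<open>dual_norm N' z\<close> to the dual norm of the combination can be
  normalised on either side, which turns the maximum into the reciprocal of a minimum. The set is
  empty exactly when the maximum is \<open>0\<close>, in accordance with \<open>1 / \<infinity> = 0\<close>.\<close>

lemma H_J_dual_minimum: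
  assumes N: "is_norm N" and N': "is_norm N'" and J: "J \<in> rel_surj_sets A C"
  shows "\<exists>\<mu>. is_minimum
      {ereal (dual_norm N (adjoint_comb A C v z)) | v z.
         v \<in> range ((*v) A) \<and> z \<in> orthant_face J \<and> dual_norm N' z = 1} \<mu> \<and>
    H_J N N' A C J = 1 / \<mu>"
    (is "\<exists>\<mu>. is_minimum ?S \<mu> \<and> _")
proof -
  note dN = is_norm_dual_norm[OF N] and dN' = is_norm_dual_norm[OF N']
  obtain M v0 z0 where H: "H_J N N' A C J = ereal M" "0 \<le> M"
    and p0: "v0 \<in> range ((*v) A)" "z0 \<in> orthant_face J" "dual_norm N' z0 = M"
      "dual_norm N (adjoint_comb A C v0 z0) \<le> 1"
    and bound: "\<And>v z. z \<in> orthant_face J \<Longrightarrow> dual_norm N' z \<le> M * dual_norm N (adjoint_comb A C v z)"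
    by (rule H_J_attained[OF N N' J]) blast
  show ?thesis
  proof (cases "M = 0")
    case True
    have "?S = {}" using bound True by fastforce
    then show ?thesis using H(1) True by (intro exI[of _ \<infinity>]) (simp add: is_minimum_def zero_ereal_def)
  next
    case False
    with H(2) have M: "0 < M" by simp
    have lower: "1 / M \<le> dual_norm N (adjoint_comb A C v z)"
      if "z \<in> orthant_face J" "dual_norm N' z = 1" for v z
      using bound[OF that(1), of v] that(2) M by (simp add: field_simps)
    let ?v = "(1 / M) *\<^sub>R v0" and ?z = "(1 / M) *\<^sub>R z0"
    obtain x where "v0 = A *v x" using p0(1) by blast
    then have "?v = A *v ((1 / M) *\<^sub>R x)" by (simp add: matrix_vector_mult_scaleR)
    then have v: "?v \<in> range ((*v) A)" by blast
    have z: "?z \<in> orthant_face J" "dual_norm N' ?z = 1"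
      using M p0 by (auto simp: orthant_face_scaleR is_norm_scaleR[OF dN'])
    have "dual_norm N (adjoint_comb A C ?v ?z) \<le> 1 / M"
      using p0(4) M by (simp only: adjoint_comb_scaleR is_norm_scaleR[OF dN]) (simp add: field_simps)
    with lower[OF z, of ?v] have "dual_norm N (adjoint_comb A C ?v ?z) = 1 / M" by simp
    then have "ereal (1 / M) \<in> ?S" using v z by force
    then have "is_minimum ?S (ereal (1 / M))" using lower by (auto simp: is_minimum_def)
    then show ?thesis using H(1) M by (intro exI[of _ "ereal (1 / M)"]) (simp add: one_ereal_def)
  qed
qed

lemma H_J_mono: "J \<subseteq> K \<Longrightarrow> H_J N N' A C J \<le> H_J N N' A C K"
  unfolding H_J_def min_norm_J_def
  by (intro SUP_mono' INF_superset_mono) (auto simp: feasible_J_def)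

section \<open>The error bound and its tightness\<close>

lemma empty_in_rel_surj_sets: "{} \<in> rel_surj_sets A C"
  by (auto simp: rel_surj_sets_iff_trivial_kernel trivial_kernel_def orthant_face_def vec_eq_iff)

lemma hoffman_H_attained:
  assumes N: "is_norm N" and N': "is_norm N'"
  obtains h J where "hoffman_H N N' A C = ereal h" "0 \<le> h"
    "J \<in> rel_surj_sets A C" "H_J N N' A C J = ereal h"
    "\<And>K. K \<in> rel_surj_sets A C \<Longrightarrow> H_J N N' A C K \<le> ereal h"
proof -
  have fin: "finite (H_J N N' A C ` rel_surj_sets A C)" by simp
  have "H_J N N' A C ` rel_surj_sets A C \<noteq> {}" using empty_in_rel_surj_sets by blast
  then obtain J where J: "J \<in> rel_surj_sets A C" "hoffman_H N N' A C = H_J N N' A C J"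
    using Max_in[OF fin] unfolding hoffman_H_def by blast
  have le: "H_J N N' A C K \<le> H_J N N' A C J" if "K \<in> rel_surj_sets A C" for K
    using Max_ge[OF fin imageI[OF that]] J(2) by (simp add: hoffman_H_def)
  obtain h where "H_J N N' A C J = ereal h" "0 \<le> h"
    by (rule H_J_attained[OF N N' J(1)]) blast
  with J le that show ?thesis by metis
qed

text \<open>Consistency of \<open>A y = 0\<close>, \<open>C y \<le> e\<close> makes \<open>z' \<bullet> e \<ge> 0\<close> for every pair of multipliers in the
  kernel. Subtracting the largest multiple of such a pair that keeps \<open>z\<close> nonnegative does not
  increase \<open>z \<bullet> e\<close>, keeps the combination, and removes an index from the support; once no
  such pair is left, the kernel on the support is trivial. This is the Caratheodory argument for
  conic combinations.\<close>

lemma multiplier_support_reduction: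
  fixes A :: "real ^ 'n ^ 'm" and C :: "real ^ 'n ^ 'p"
  assumes y0: "A *v y0 = 0" "C *v y0 \<le> e" and z: "0 \<le> z"
  shows "\<exists>v' z'. 0 \<le> z' \<and> adjoint_comb A C v' z' = adjoint_comb A C v z \<and> z' \<bullet> e \<le> z \<bullet> e \<and>
           trivial_kernel A C {i. z' $ i \<noteq> 0}"
  using z
proof (induction "card {i. z $ i \<noteq> 0}" arbitrary: v z rule: less_induct)
  case less
  show ?case
  proof (cases "trivial_kernel A C {i. z $ i \<noteq> 0}")
    case True
    with less.prems show ?thesis by blast
  next
    case False
    then obtain v1 z1 where z1: "z1 \<in> orthant_face {i. z $ i \<noteq> 0}" "adjoint_comb A C v1 z1 = 0" "z1 \<noteq> 0"
      unfolding trivial_kernel_def by blast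
    have z1_nonneg: "0 \<le> z1 $ i" for i using z1(1) by (simp add: orthant_face_def less_eq_vec_def)
    have z1_supp: "z $ i = 0 \<Longrightarrow> z1 $ i = 0" for i using z1(1) by (simp add: orthant_face_def)
    have "z1 \<bullet> (C *v y0) = 0" using adjoint_comb_inner[of A C v1 z1 y0] z1(2) y0(1) by simp
    moreover have "z1 \<bullet> (C *v y0) \<le> z1 \<bullet> e"
      using y0(2) by (intro orthant_face_inner_le[OF z1(1)]) (simp add: less_eq_vec_def)
    ultimately have e: "0 \<le> z1 \<bullet> e" by simp
    define I where "I = {i. 0 < z1 $ i}"
    have I: "finite I" "I \<noteq> {}"
      using z1(3) z1_nonneg by (auto simp: I_def vec_eq_iff order.strict_iff_order)
    define l where "l = Min ((\<lambda>i. z $ i / z1 $ i) ` I)"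
    have "l \<in> (\<lambda>i. z $ i / z1 $ i) ` I" unfolding l_def using I by (intro Min_in) auto
    then obtain k where k: "k \<in> I" "l = z $ k / z1 $ k" by blast
    have zn: "0 \<le> z $ i" for i using less.prems by (simp add: less_eq_vec_def)
    have l: "0 \<le> l" using k zn[of k] by (simp add: I_def)
    define z2 where "z2 = z - l *\<^sub>R z1"
    have "0 \<le> z2 $ i" for i
    proof (cases "i \<in> I")
      case True
      then have "l \<le> z $ i / z1 $ i" unfolding l_def using I by (intro Min_le) auto
      with True show ?thesis by (simp add: z2_def I_def field_simps)
    next
      case False
      with z1_nonneg[of i] have "z1 $ i = 0" by (simp add: I_def)
      with zn show ?thesis by (simp add: z2_def)
    qed
    then have z2: "0 \<le> z2" by (simp add: less_eq_vec_def)
    have "z2 $ k = 0" using k by (simp add: z2_def I_def)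
    moreover have "z $ k \<noteq> 0" using k(1) z1_supp[of k] by (auto simp: I_def)
    moreover have "z2 $ i = 0" if "z $ i = 0" for i using z1_supp[OF that] that by (simp add: z2_def)
    ultimately have "{i. z2 $ i \<noteq> 0} \<subset> {i. z $ i \<noteq> 0}" by blast
    then have "card {i. z2 $ i \<noteq> 0} < card {i. z $ i \<noteq> 0}" by (intro psubset_card_mono) auto
    from less.hyps[OF this z2, of "v - l *\<^sub>R v1"] obtain v' z' where
      "0 \<le> z'" "adjoint_comb A C v' z' = adjoint_comb A C (v - l *\<^sub>R v1) z2" "z' \<bullet> e \<le> z2 \<bullet> e"
      "trivial_kernel A C {i. z' $ i \<noteq> 0}" by blast
    moreover have "adjoint_comb A C (v - l *\<^sub>R v1) z2 = adjoint_comb A C v z"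
      by (simp add: z2_def adjoint_comb_diff adjoint_comb_scaleR z1(2))
    moreover have "z2 \<bullet> e \<le> z \<bullet> e" using l e by (simp add: z2_def inner_diff_left)
    ultimately show ?thesis by force
  qed
qed

lemma shifted_orthant_eq: "shifted_orthant y = {x. y \<le> x}"
proof -
  have "\<exists>s. x = y + s \<and> 0 \<le> s" if "y \<le> x" for x
    using that by (intro exI[of _ "x - y"]) (simp add: less_eq_vec_def)
  then show ?thesis by (auto simp: shifted_orthant_def less_eq_vec_def)
qed

lemma closed_shifted_orthant: "closed (shifted_orthant y)"
  unfolding shifted_orthant_eq less_eq_vec_def
  by (intro closed_Collect_all closed_Collect_le continuous_intros)

lemma norm_dist_shifted_orthant_le:
  assumes "is_norm N'"
  shows "norm_dist N' d (shifted_orthant y) \<le> N' (pos_part (y - d))"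
proof -
  have "d + pos_part (y - d) \<in> shifted_orthant y"
    by (auto simp: shifted_orthant_eq less_eq_vec_def pos_part_def max_def)
  from norm_dist_le[OF assms this, of d] show ?thesis by (simp add: is_norm_minus[OF assms])
qed

text \<open>With \<open>e = d - C u\<close> and \<open>q\<close> the point of the shifted orthant nearest to \<open>d\<close>, the residual
  \<open>w = d - q\<close> satisfies \<open>w \<le> e\<close>. If no solution lay within the claimed distance of \<open>u\<close>, separation would give multipliers \<open>z\<close>, which by support reduction may
  be taken supported on a relatively surjective \<open>J\<close>; the bound by \<open>H\<^sub>J\<close> for such multipliers
  contradicts the separation.\<close>

lemma hoffman_error_bound:
  fixes A :: "real ^ 'n ^ 'm" and C :: "real ^ 'n ^ 'p"
  assumes N: "is_norm N" and N': "is_norm N'"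
    and h: "0 \<le> h" "\<And>K. K \<in> rel_surj_sets A C \<Longrightarrow> H_J N N' A C K \<le> ereal h"
    and ne: "affine_sols A b \<inter> polyhedron_of C d \<noteq> {}" and u: "u \<in> affine_sols A b"
  shows "norm_dist N u (affine_sols A b \<inter> polyhedron_of C d)
    \<le> h * norm_dist N' d (shifted_orthant (C *v u))"
proof -
  note dN = is_norm_dual_norm[OF N]
  have "shifted_orthant (C *v u) \<noteq> {}" by (auto simp: shifted_orthant_eq)
  then obtain q where q: "q \<in> shifted_orthant (C *v u)"
    "norm_dist N' d (shifted_orthant (C *v u)) = N' (d - q)"
    using norm_dist_attained[OF N' closed_shifted_orthant] by metis
  define w where "w = d - q"
  define e where "e = d - C *v u"
  have we: "w \<le> e" using q(1) by (simp add: w_def e_def shifted_orthant_eq less_eq_vec_def)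
  obtain x0 where "A *v x0 = b" "C *v x0 \<le> d" using ne by (auto simp: affine_sols_def polyhedron_of_def)
  then have y0: "A *v (x0 - u) = 0" "C *v (x0 - u) \<le> e"
    using u by (auto simp: affine_sols_def e_def matrix_vector_mult_diff_distrib less_eq_vec_def)
  have hw: "0 \<le> h * N' w" using h(1) is_norm_nonneg[OF N'] by simp
  have "\<exists>y\<in>feasible_J A C UNIV e. N y \<le> h * N' w"
  proof (rule ccontr)
    assume "\<not> ?thesis"
    then have none: "h * N' w < N y" if "y \<in> feasible_J A C UNIV e" for y using that by force
    from bounded_solution_or_multiplier[OF N hw none] obtain v z where z: "z \<in> orthant_face UNIV"
      and sep: "z \<bullet> e < - (h * N' w * dual_norm N (adjoint_comb A C v z))" by metis
    have "0 \<le> z" using z by (simp add: orthant_face_def)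
    from multiplier_support_reduction[OF y0 this, of v] obtain v' z' where
      z': "0 \<le> z'" "adjoint_comb A C v' z' = adjoint_comb A C v z" "z' \<bullet> e \<le> z \<bullet> e"
      and J: "{i. z' $ i \<noteq> 0} \<in> rel_surj_sets A C"
      unfolding rel_surj_sets_iff_trivial_kernel by blast
    let ?t = "dual_norm N (adjoint_comb A C v z)"
    have face: "z' \<in> orthant_face {i. z' $ i \<noteq> 0}" using z'(1) by (simp add: orthant_face_def)
    obtain M where M: "H_J N N' A C {i. z' $ i \<noteq> 0} = ereal M"
      and bound: "\<And>v z. z \<in> orthant_face {i. z' $ i \<noteq> 0} \<Longrightarrow>
        dual_norm N' z \<le> M * dual_norm N (adjoint_comb A C v z)"
      by (rule H_J_attained[OF N N' J]) blast
    have "M \<le> h" using h(2)[OF J] M by simp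
    have "- (z' \<bullet> e) \<le> - (z' \<bullet> w)"
      using orthant_face_inner_le[OF face, of w e] we by (simp add: less_eq_vec_def)
    also have "\<dots> \<le> dual_norm N' z' * N' w"
      using inner_le_dual_norm[OF N', of z' "- w"] by (simp add: is_norm_minus[OF N'])
    also have "\<dots> \<le> (M * ?t) * N' w"
      using bound[OF face, of v'] by (intro mult_right_mono is_norm_nonneg[OF N']) (simp add: z'(2))
    also have "\<dots> \<le> (h * ?t) * N' w"
      by (intro mult_right_mono is_norm_nonneg[OF N'] is_norm_nonneg[OF dN] \<open>M \<le> h\<close>)
    finally show False using sep z'(3) by (simp add: mult.commute mult.left_commute)
  qed
  then obtain y where y: "y \<in> feasible_J A C UNIV e" "N y \<le> h * N' w" by blast
  then have "u + y \<in> affine_sols A b \<inter> polyhedron_of C d"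
    using u by (auto simp: feasible_J_def affine_sols_def polyhedron_of_def e_def
        matrix_vector_right_distrib less_eq_vec_def algebra_simps)
  from norm_dist_le[OF N this, of u] y(2) show ?thesis
    by (simp add: is_norm_minus[OF N] q(2) w_def)
qed

text \<open>Take \<open>b = 0\<close>, \<open>u = 0\<close> and the extremal \<open>w\<close> of an optimal \<open>J\<close>, raised outside \<open>J\<close> until a
  solution of least norm of the subsystem satisfies the remaining inequalities. The distance to the
  solution set is then \<open>h\<close>, while the residual distance is at most \<open>N' w \<le> 1\<close>; it cannot be
  smaller than \<open>1\<close> because of the error bound.\<close>

lemma hoffman_error_bound_tight:
  fixes A :: "real ^ 'n ^ 'm" and C :: "real ^ 'n ^ 'p"
  assumes N: "is_norm N" and N': "is_norm N'" and J: "J \<in> rel_surj_sets A C"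
    and hJ: "H_J N N' A C J = ereal h" and pos: "0 < h"
    and h: "\<And>K. K \<in> rel_surj_sets A C \<Longrightarrow> H_J N N' A C K \<le> ereal h"
  shows "\<exists>b d u. affine_sols A b \<inter> polyhedron_of C d \<noteq> {} \<and>
    u \<in> affine_sols A b - polyhedron_of C d \<and>
    norm_dist N u (affine_sols A b \<inter> polyhedron_of C d)
      = h * norm_dist N' d (shifted_orthant (C *v u))"
proof -
  obtain M w where M: "H_J N N' A C J = ereal M" and ne: "\<And>w. feasible_J A C J w \<noteq> {}"
    and w: "N' w \<le> 1" "min_norm_J N A C J w = ereal M"
    by (rule H_J_attained[OF N N' J]) blast
  obtain x where x: "x \<in> feasible_J A C J w" "min_norm_J N A C J w = ereal (N x)"
    "\<And>y. y \<in> feasible_J A C J w \<Longrightarrow> N x \<le> N y"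
    using min_norm_J_attained[OF N ne] by metis
  have Nx: "N x = h" using M w(2) x(2) hJ by simp
  define d where "d = (\<chi> i. if i \<in> J then w $ i else max (w $ i) ((C *v x) $ i))"
  let ?S = "affine_sols A 0 \<inter> polyhedron_of C d"
  have xS: "x \<in> ?S"
    using x(1) by (auto simp: feasible_J_def affine_sols_def polyhedron_of_def d_def less_eq_vec_def)
  have S_sub: "?S \<subseteq> feasible_J A C J w"
    by (auto simp: feasible_J_def affine_sols_def polyhedron_of_def d_def less_eq_vec_def split: if_splits)
  have u: "0 \<in> affine_sols A 0" by (simp add: affine_sols_def)
  have dist: "h \<le> norm_dist N 0 ?S"
    unfolding norm_dist_def
  proof (rule cINF_greatest)
    show "?S \<noteq> {}" using xS by blast
    fix y assume "y \<in> ?S"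
    then show "h \<le> N (0 - y)" using S_sub x(3)[of y] Nx by (auto simp: is_norm_minus[OF N])
  qed
  have "norm_dist N 0 ?S \<le> h" using norm_dist_le[OF N xS, of 0] by (simp add: is_norm_minus[OF N] Nx)
  with dist have eq: "norm_dist N 0 ?S = h" by simp
  let ?r = "norm_dist N' d (shifted_orthant (C *v 0))"
  have "d - w \<in> shifted_orthant (C *v 0)" by (auto simp: shifted_orthant_eq d_def less_eq_vec_def)
  from norm_dist_le[OF N' this, of d] w(1) have "?r \<le> 1" by simp
  moreover have "h \<le> h * ?r"
    using hoffman_error_bound[OF N N' less_imp_le[OF pos] h _ u, of d] xS eq by auto
  then have "1 \<le> ?r" using pos by simp
  ultimately have r: "?r = 1" by simp
  have "0 \<notin> polyhedron_of C d"
  proof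
    assume "0 \<in> polyhedron_of C d"
    with u have "0 \<in> ?S" by blast
    from norm_dist_le[OF N this, of 0] have "norm_dist N 0 ?S \<le> 0"
      using is_norm_eq_0_iff[OF N, of 0] by simp
    with eq pos show False by simp
  qed
  with u xS eq r show ?thesis by (intro exI[of _ 0] exI[of _ d]) auto
qed

lemma surjective_imp_range_and_maximal:
  fixes A :: "real ^ 'n ^ 'm" and C :: "real ^ 'n ^ 'p"
  assumes N: "is_norm N" and N': "is_norm N'" and surj: "sv_surjective (sv_map A C UNIV)"
  shows "UNIV \<in> rel_surj_sets A C" "range ((*v) A) = UNIV" "hoffman_H N N' A C = H_J N N' A C UNIV"
proof -
  show J: "UNIV \<in> rel_surj_sets A C"
    using surj by (simp add: rel_surj_sets_def sv_relatively_surjective_def sv_surjective_def)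
  have "b \<in> range ((*v) A)" for b
  proof -
    have "(b, 0) \<in> (\<Union>x. sv_map A C UNIV x)" using surj by (simp add: sv_surjective_def)
    then show ?thesis by (auto simp: sv_map_def)
  qed
  then show "range ((*v) A) = UNIV" by blast
  show "hoffman_H N N' A C = H_J N N' A C UNIV"
    unfolding hoffman_H_def using J by (intro Max_eqI) (auto intro!: H_J_mono)
qed

theorem proposition7:
  fixes A :: "real ^ 'n ^ 'm" and C :: "real ^ 'n ^ 'p"
    and N :: "real ^ 'n \<Rightarrow> real" and N' :: "real ^ 'p \<Rightarrow> real"
  assumes "is_norm N" and "is_norm N'"
  shows
    "(\<forall>J \<in> rel_surj_sets A C.
       (\<forall>w. N' w \<le> 1 \<longrightarrow>
          is_minimum ((\<lambda>x. ereal (N x)) ` feasible_J A C J w) (min_norm_J N A C J w)) \<and>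
       is_maximum (min_norm_J N A C J ` {w. N' w \<le> 1}) (H_J N N' A C J) \<and>
       is_maximum
         {ereal (dual_norm N' z) | v z.
            v \<in> range ((*v) A) \<and> 0 \<le> z \<and> (\<forall>i\<in>- J. z $ i = 0) \<and>
            dual_norm N (transpose A *v v + transpose C *v z) \<le> 1}
         (H_J N N' A C J) \<and>
       (\<exists>\<mu>. is_minimum
              {ereal (dual_norm N (transpose A *v v + transpose C *v z)) | v z.
                 v \<in> range ((*v) A) \<and> 0 \<le> z \<and> (\<forall>i\<in>- J. z $ i = 0) \<and> dual_norm N' z = 1}
              \<mu> \<and>
            H_J N N' A C J = 1 / \<mu>)) \<and>
     (\<forall>b d u. affine_sols A b \<inter> polyhedron_of C d \<noteq> {} \<and> u \<in> affine_sols A b \<longrightarrow>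
       ereal (norm_dist N u (affine_sols A b \<inter> polyhedron_of C d))
         \<le> hoffman_H N N' A C * ereal (norm_dist N' d (shifted_orthant (C *v u))) \<and>
       hoffman_H N N' A C * ereal (norm_dist N' d (shifted_orthant (C *v u)))
         \<le> hoffman_H N N' A C * ereal (N' (pos_part (C *v u - d)))) \<and>
     (0 < hoffman_H N N' A C \<longrightarrow>
       (\<exists>b d u. affine_sols A b \<inter> polyhedron_of C d \<noteq> {} \<and>
          u \<in> affine_sols A b - polyhedron_of C d \<and>
          ereal (norm_dist N u (affine_sols A b \<inter> polyhedron_of C d))
            = hoffman_H N N' A C * ereal (norm_dist N' d (shifted_orthant (C *v u))))) \<and>
     (sv_surjective (sv_map A C UNIV) \<longrightarrow>
       is_maximum
         {ereal (dual_norm N' z) | v z.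
            0 \<le> z \<and> dual_norm N (transpose A *v v + transpose C *v z) \<le> 1}
         (hoffman_H N N' A C) \<and>
       (\<exists>\<mu>. is_minimum
              {ereal (dual_norm N (transpose A *v v + transpose C *v z)) | v z.
                 0 \<le> z \<and> dual_norm N' z = 1}
              \<mu> \<and>
            hoffman_H N N' A C = 1 / \<mu>))"
proof -
  note N = assms(1) and N' = assms(2)
  obtain h J where H: "hoffman_H N N' A C = ereal h" "0 \<le> h"
    and J: "J \<in> rel_surj_sets A C" "H_J N N' A C J = ereal h"
    and h: "\<And>K. K \<in> rel_surj_sets A C \<Longrightarrow> H_J N N' A C K \<le> ereal h"
    by (rule hoffman_H_attained[OF N N']) blast
  note dual = H_J_dual_maximum[OF N N'] H_J_dual_minimum[OF N N']
  note dual_unfolded = dual[unfolded adjoint_comb_def orthant_face_def mem_Collect_eq conj_assoc]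
  have subsystems: "\<forall>J \<in> rel_surj_sets A C.
       (\<forall>w. N' w \<le> 1 \<longrightarrow>
          is_minimum ((\<lambda>x. ereal (N x)) ` feasible_J A C J w) (min_norm_J N A C J w)) \<and>
       is_maximum (min_norm_J N A C J ` {w. N' w \<le> 1}) (H_J N N' A C J) \<and>
       is_maximum
         {ereal (dual_norm N' z) | v z.
            v \<in> range ((*v) A) \<and> 0 \<le> z \<and> (\<forall>i\<in>- J. z $ i = 0) \<and>
            dual_norm N (transpose A *v v + transpose C *v z) \<le> 1}
         (H_J N N' A C J) \<and>
       (\<exists>\<mu>. is_minimum
              {ereal (dual_norm N (transpose A *v v + transpose C *v z)) | v z.
                 v \<in> range ((*v) A) \<and> 0 \<le> z \<and> (\<forall>i\<in>- J. z $ i = 0) \<and> dual_norm N' z = 1}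
              \<mu> \<and>
            H_J N N' A C J = 1 / \<mu>)"
    by (intro ballI allI impI conjI H_J_primal_attained[OF N N'] dual_unfolded)
  have bound: "\<forall>b d u. affine_sols A b \<inter> polyhedron_of C d \<noteq> {} \<and> u \<in> affine_sols A b \<longrightarrow>
       ereal (norm_dist N u (affine_sols A b \<inter> polyhedron_of C d))
         \<le> hoffman_H N N' A C * ereal (norm_dist N' d (shifted_orthant (C *v u))) \<and>
       hoffman_H N N' A C * ereal (norm_dist N' d (shifted_orthant (C *v u)))
         \<le> hoffman_H N N' A C * ereal (N' (pos_part (C *v u - d)))"
    using hoffman_error_bound[OF N N' H(2) h]
      mult_left_mono[OF norm_dist_shifted_orthant_le[OF N'] H(2)]
    by (auto simp: H(1))
  have tight: "0 < hoffman_H N N' A C \<longrightarrow>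
       (\<exists>b d u. affine_sols A b \<inter> polyhedron_of C d \<noteq> {} \<and>
          u \<in> affine_sols A b - polyhedron_of C d \<and>
          ereal (norm_dist N u (affine_sols A b \<inter> polyhedron_of C d))
            = hoffman_H N N' A C * ereal (norm_dist N' d (shifted_orthant (C *v u))))"
    using hoffman_error_bound_tight[OF N N' J _ h] by (simp add: H(1))
  have surjective: "sv_surjective (sv_map A C UNIV) \<longrightarrow>
       is_maximum
         {ereal (dual_norm N' z) | v z.
            0 \<le> z \<and> dual_norm N (transpose A *v v + transpose C *v z) \<le> 1}
         (hoffman_H N N' A C) \<and>
       (\<exists>\<mu>. is_minimum
              {ereal (dual_norm N (transpose A *v v + transpose C *v z)) | v z.
                 0 \<le> z \<and> dual_norm N' z = 1}
              \<mu> \<and>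
            hoffman_H N N' A C = 1 / \<mu>)"
  proof
    assume surj: "sv_surjective (sv_map A C UNIV)"
    note facts = surjective_imp_range_and_maximal[OF N N' surj]
    show "is_maximum
         {ereal (dual_norm N' z) | v z.
            0 \<le> z \<and> dual_norm N (transpose A *v v + transpose C *v z) \<le> 1}
         (hoffman_H N N' A C) \<and>
       (\<exists>\<mu>. is_minimum
              {ereal (dual_norm N (transpose A *v v + transpose C *v z)) | v z.
                 0 \<le> z \<and> dual_norm N' z = 1}
              \<mu> \<and>
            hoffman_H N N' A C = 1 / \<mu>)"
      using dual_unfolded(1)[OF facts(1)] dual_unfolded(2)[OF facts(1)]
      by (simp add: facts(2) facts(3))
  qed
  show ?thesis
    by (intro conjI subsystems bound tight surjective)
qed

end
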